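(* For every integer $k\geq 1$, the limit $\lim_{\ell\rightarrow\infty}P_{k,\ell}$ (over integers $\ell\geq 1$) exists and satisfies \[ \lim_{\ell\rightarrow\infty} P_{k,\ell} \geq \frac{1}{2}-\frac{1}{\sqrt{2\pi k}}. \]
   Context: For integers $k,\ell\geq 1$ define \[ P_{k,\ell} = \frac{(k+\ell)!}{(k-1)!\,\ell!}\int_{k/(k+\ell)}^1 t^{k-1}(1-t)^\ell\,dt. \] *)

theory Defs
  imports "HOL-Analysis.Analysis"
begin

(* Meant for k >= 1 and l >= 1, where the truncated subtraction k - 1 is harmless. *)
definition P :: "nat \<Rightarrow> nat \<Rightarrow> real" where
  "P k l = fact (k + l) / (fact (k - 1) * fact l) *
     integral {real k / real (k + l)..1} (\<lambda>t::real. t ^ (k - 1) * (1 - t) ^ l)"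

end

theory Submission
  imports Defs
begin

text \<open>
  Integrating the Beta density shows that $P_{k,\ell}$ is the probability that a binomial variable
  with parameters $k + \ell$ and $k / (k + \ell)$ is less than $k$, so its limit is
  $\Pr[X < k]$ for a Poisson variable $X$ with mean $k$. It remains to combine
  $\Pr[X \le k] \ge 1/2$ with $\Pr[X = k] = e^{-k} k^k / k! \le 1 / \sqrt{2 \pi k}$.
  The first bound holds because $G(x) = \sum_{j \le k} e^{-x} x^j / j!$ has derivative
  $- e^{-x} x^k / k!$, which is larger in absolute value at $k + s$ than at $k - s$; hence
  $G(k - s) + G(k + s)$ decreases in $s$ and $2 G(k) \ge G(0) + G(2k) \ge 1$. The second is
  Stirling's lower bound: the remainder in Stirling's formula is decreasing, and its limit is
  determined by Wallis' product.
\<close>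

section \<open>From the Beta integral to the Poisson distribution function\<close>

text \<open>The sum telescopes under differentiation: each summand contributes two terms, and
  neighbouring ones cancel because
  \<open>(j + 1) * (n choose (j + 1)) = (n - j) * (n choose j)\<close>. Only the last term survives,
  a multiple of a Beta density.\<close>

lemma binomial_cdf_has_real_derivative:
  assumes "m < n"
  shows "((\<lambda>t. \<Sum>j\<le>m. real (n choose j) * t ^ j * (1 - t) ^ (n - j)) has_real_derivative
           - (real (Suc m) * real (n choose Suc m) * (t ^ m * (1 - t) ^ (n - Suc m)))) (at t)"
  using assms
proof (induction m)
  case 0
  then show ?case
    by (auto intro!: derivative_eq_intros)
next
  case (Suc m)
  have absorb: "real (Suc (Suc m)) * real (n choose Suc (Suc m)) = real (n - Suc m) * real (n choose Suc m)"
    unfolding of_nat_mult [symmetric] binomial_absorption binomial_absorb_comp ..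
  have "((\<lambda>t. real (n choose Suc m) * t ^ Suc m * (1 - t) ^ (n - Suc m)) has_real_derivative
      real (Suc m) * real (n choose Suc m) * (t ^ m * (1 - t) ^ (n - Suc m))
      - real (n - Suc m) * real (n choose Suc m) * (t ^ Suc m * (1 - t) ^ (n - Suc (Suc m)))) (at t)"
    by (rule derivative_eq_intros DERIV_pow refl)+ (simp add: algebra_simps)
  from DERIV_add[OF Suc.IH this] Suc.prems show ?case
    unfolding absorb by simp
qed

lemma P_eq_binomial_cdf:
  assumes "k \<ge> 1"
  shows "P k l = (\<Sum>j<k. real ((k + l) choose j) * (real k / real (k + l)) ^ j
                   * (1 - real k / real (k + l)) ^ (k + l - j))"
proof -
  define n where "n = k + l"
  define p where "p = real k / real n"
  obtain m where m: "k = Suc m"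
    using assms by (cases k) auto
  define F where "F = (\<lambda>t::real. \<Sum>j\<le>m. real (n choose j) * t ^ j * (1 - t) ^ (n - j))"
  \<comment> \<open>This is the prefactor in \<open>P\<close>, as
    \<open>(k + l)! / ((k - 1)! * l!) = k * (n choose k)\<close>.\<close>
  define c where "c = real (Suc m) * real (n choose Suc m)"
  have mn: "m < n" and l: "n - Suc m = l"
    by (auto simp: n_def m)
  have p1: "p \<le> 1"
    by (simp add: p_def n_def m)
  \<comment> \<open>Every exponent \<open>n - j\<close> is positive since
    \<open>j \<le> m < n\<close>.\<close>
  have F1: "F 1 = 0"
    unfolding F_def using mn by (intro sum.neutral) auto
  have "((\<lambda>t. - (c * (t ^ m * (1 - t) ^ l))) has_integral F 1 - F p) {p..1}"
    by (intro fundamental_theorem_of_calculus p1)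
      (use binomial_cdf_has_real_derivative[OF mn] in
        \<open>auto simp: F_def c_def l has_real_derivative_iff_has_vector_derivative [symmetric]
           intro: has_field_derivative_at_within\<close>)
  then have int: "c * integral {p..1} (\<lambda>t. t ^ m * (1 - t) ^ l) = F p"
    using F1 by (auto dest!: integral_unique)
  have "real (n choose k) = fact n / (fact k * fact (n - k))"
    by (rule binomial_fact) (simp add: n_def)
  moreover have "fact k = real (Suc m) * fact m" "n - k = l"
    by (simp_all add: m n_def)
  ultimately have "c = fact n / (fact m * fact l)"
    by (simp add: c_def m del: of_nat_Suc fact_Suc)
  with int show ?thesis
    unfolding P_def F_def by (simp add: m n_def p_def lessThan_Suc_atMost)
qed

text \<open>For fixed \<open>j\<close> the term splits into a falling product tending to 1,
  \<open>(1 - c / n) ^ n\<close> tending to \<open>exp (- c)\<close>, the inverse of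
  \<open>(1 - c / n) ^ j\<close> tending to 1, and the constant
  \<open>c ^ j / fact j\<close>.\<close>

lemma binomial_pmf_tendsto_poisson_pmf:
  fixes c :: real
  shows "(\<lambda>n. real (n choose j) * (c / real n) ^ j * (1 - c / real n) ^ (n - j))
           \<longlonglongrightarrow> exp (- c) * c ^ j / fact j"
proof -
  have 1: "(\<lambda>n. \<Prod>i<j. 1 - real i / real n) \<longlonglongrightarrow> (\<Prod>i<j. 1 - 0)"
    by (intro tendsto_intros tendsto_divide_0[OF tendsto_const] filterlim_at_top_imp_at_infinity
        filterlim_real_sequentially)
  have 2: "(\<lambda>n. (1 + (- c) / real n) ^ n) \<longlonglongrightarrow> exp (- c)"
    by (rule tendsto_exp_limit_sequentially)
  have 3: "(\<lambda>n. (1 - c / real n) ^ j) \<longlonglongrightarrow> (1 - 0) ^ j"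
    by (intro tendsto_intros tendsto_divide_0[OF tendsto_const] filterlim_at_top_imp_at_infinity
        filterlim_real_sequentially)
  have "(\<lambda>n. (\<Prod>i<j. 1 - real i / real n) * (1 + (- c) / real n) ^ n / (1 - c / real n) ^ j
          * (c ^ j / fact j)) \<longlonglongrightarrow> (\<Prod>i<j. 1 - 0) * exp (- c) / (1 - 0) ^ j * (c ^ j / fact j)"
    by (intro tendsto_mult tendsto_divide 1 2 3 tendsto_const) auto
  moreover have "eventually (\<lambda>n. (\<Prod>i<j. 1 - real i / real n) * (1 + (- c) / real n) ^ n
          / (1 - c / real n) ^ j * (c ^ j / fact j)
      = real (n choose j) * (c / real n) ^ j * (1 - c / real n) ^ (n - j)) sequentially"
    \<comment> \<open>Beyond this threshold \<open>1 - c / real n\<close> is nonzero and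
      \<open>n - j\<close> is not truncated.\<close>
    using eventually_gt_at_top[of "nat \<lceil>\<bar>c\<bar>\<rceil> + j"]
  proof eventually_elim
    case (elim n)
    then have n: "real n > 0" "j \<le> n" "c < real n"
      by linarith+
    then have nz: "1 - c / real n \<noteq> 0"
      by (auto simp: field_simps)
    have "real (n choose j) = (\<Prod>i<j. real n - real i) / fact j"
      using binomial_gbinomial[of n j, where 'a = real]
      by (simp add: gbinomial_prod_rev atLeast0LessThan)
    also have "(\<Prod>i<j. real n - real i) = (\<Prod>i<j. (1 - real i / real n) * real n)"
      using n by (intro prod.cong) (auto simp: field_simps)
    also have "\<dots> = (\<Prod>i<j. 1 - real i / real n) * real n ^ j"
      by (simp add: prod.distrib)
    finally have "real (n choose j) * (c / real n) ^ j = (\<Prod>i<j. 1 - real i / real n) * (c ^ j / fact j)"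
      using n by (simp add: power_divide)
    moreover have "(1 - c / real n) ^ (n - j) = (1 + (- c) / real n) ^ n / (1 - c / real n) ^ j"
      using nz n by (simp add: power_diff)
    ultimately show ?case
      by (simp add: mult_ac)
  qed
  ultimately show ?thesis
    by (auto elim: Lim_transform_eventually)
qed

lemma P_tendsto_poisson_cdf:
  assumes "k \<ge> 1"
  shows "(\<lambda>l. P k l) \<longlonglongrightarrow> (\<Sum>j<k. exp (- real k) * real k ^ j / fact j)"
  unfolding P_eq_binomial_cdf[OF assms]
proof (intro tendsto_sum)
  fix j
  show "(\<lambda>l. real (k + l choose j) * (real k / real (k + l)) ^ j * (1 - real k / real (k + l)) ^ (k + l - j))
      \<longlonglongrightarrow> exp (- real k) * real k ^ j / fact j"
    using LIMSEQ_ignore_initial_segment[OF binomial_pmf_tendsto_poisson_pmf[of j "real k"], of k]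
    by (simp only: add.commute)
qed

section \<open>The median of the Poisson distribution\<close>

text \<open>Telescoping again: for \<open>j > 0\<close> the Poisson weight at \<open>j\<close> has
  as derivative the weight at \<open>j - 1\<close> minus the weight at \<open>j\<close>.\<close>

lemma poisson_cdf_has_real_derivative:
  "((\<lambda>x. \<Sum>j\<le>m. exp (- x) * x ^ j / fact j) has_real_derivative
      - (exp (- x) * x ^ m / fact m)) (at x)"
proof (induction m)
  case 0
  then show ?case
    by (auto intro!: derivative_eq_intros)
next
  case (Suc m)
  have "((\<lambda>x. x ^ Suc m / fact (Suc m)) has_real_derivative
      real (Suc m) * x ^ (Suc m - Suc 0) / fact (Suc m)) (at x)"
    by (intro DERIV_cdivide DERIV_pow)
  also have "real (Suc m) * x ^ (Suc m - Suc 0) / fact (Suc m) = x ^ m / fact m"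
    by (simp del: of_nat_Suc)
  finally have "((\<lambda>x. exp (- x) * (x ^ Suc m / fact (Suc m))) has_real_derivative
      - exp (- x) * (x ^ Suc m / fact (Suc m)) + x ^ m / fact m * exp (- x)) (at x)"
    by (intro DERIV_mult) (auto intro!: derivative_eq_intros)
  from DERIV_add[OF Suc.IH this] show ?case
    by (simp add: mult.commute del: fact_Suc power_Suc)
qed

text \<open>After taking logarithms this is the midpoint bound for the integral of the convex
  function \<open>1 / x\<close> over the interval from \<open>k - s\<close> to \<open>k + s\<close>,
  whose midpoint is \<open>k\<close>.\<close>

lemma gamma_density_reflect_le:
  fixes s :: real
  assumes "k \<ge> 1" "0 \<le> s" "s \<le> real k"
  shows "exp (- (real k - s)) * (real k - s) ^ k \<le> exp (- (real k + s)) * (real k + s) ^ k"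
proof (cases "s = 0 \<or> s = real k")
  case True
  with assms show ?thesis
    by (auto simp: power_0_left)
next
  case False
  with assms have s: "0 < s" "s < real k"
    by auto
  have "2 * s / real k \<le> ln (real k + s) - ln (real k - s)"
    using ln_inverse_approx_ge[of "real k - s" "real k + s"] s by simp
  then have "2 * s \<le> real k * ln (real k + s) - real k * ln (real k - s)"
    using s by (simp add: field_simps)
  then have "exp (- (real k - s) + real k * ln (real k - s)) \<le> exp (- (real k + s) + real k * ln (real k + s))"
    by simp
  then show ?thesis
    using s by (simp only: exp_add exp_of_nat_mult) simp
qed

lemma poisson_median_ge:
  assumes "k \<ge> 1"
  shows "(\<Sum>j\<le>k. exp (- real k) * real k ^ j / fact j) \<ge> 1 / 2"
proof -
  define G where "G = (\<lambda>x::real. \<Sum>j\<le>k. exp (- x) * x ^ j / fact j)"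
  have G: "(G has_real_derivative - (exp (- x) * x ^ k / fact k)) (at x)" for x
    unfolding G_def by (rule poisson_cdf_has_real_derivative)
  have "G (real k - real k) + G (real k + real k) \<le> G (real k - 0) + G (real k + 0)"
  proof (rule DERIV_nonpos_imp_nonincreasing[of 0 "real k" "\<lambda>s. G (real k - s) + G (real k + s)"])
    fix s :: real
    assume s: "0 \<le> s" "s \<le> real k"
    have "((\<lambda>s. G (real k - s) + G (real k + s)) has_real_derivative
        (exp (- (real k - s)) * (real k - s) ^ k / fact k - exp (- (real k + s)) * (real k + s) ^ k / fact k)) (at s)"
      by (auto intro!: derivative_eq_intros DERIV_chain2[OF G])
    moreover have "exp (- (real k - s)) * (real k - s) ^ k / fact k
        \<le> exp (- (real k + s)) * (real k + s) ^ k / fact k"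
      by (intro divide_right_mono gamma_density_reflect_le assms s) simp
    ultimately show "\<exists>y. ((\<lambda>s. G (real k - s) + G (real k + s)) has_real_derivative y) (at s) \<and> y \<le> 0"
      by (intro exI conjI) auto
  qed simp
  \<comment> \<open>Only \<open>j = 0\<close> contributes, with \<open>0 ^ 0 = 1\<close>.\<close>
  moreover have "G 0 = 1"
    unfolding G_def by (simp add: power_0_left if_distrib[of "\<lambda>x. x / _"] sum.delta cong: if_cong)
  moreover have "G (real k + real k) \<ge> 0"
    unfolding G_def by (intro sum_nonneg) auto
  ultimately show ?thesis
    by (simp add: G_def)
qed

section \<open>Stirling's lower bound for the factorial\<close>

text \<open>For \<open>n \<ge> 1\<close> this is the logarithm of the ratio of \<open>n!\<close> to
  \<open>sqrt n * (n / e) ^ n\<close>.\<close>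

definition stirling_remainder :: "nat \<Rightarrow> real" where
  "stirling_remainder n = ln (fact n) - (real n + 1 / 2) * ln (real n) + real n"

text \<open>The decrement is \<open>n + 1/2\<close> times the integral of \<open>1 / x\<close> from
  \<open>n\<close> to \<open>n + 1\<close>, minus 1. The midpoint rule bounds it below by 0; the
  trapezoidal rule bounds it above by \<open>1 / (4 * n * (n + 1))\<close>, written as a telescoping
  difference.\<close>

lemma stirling_remainder_step:
  assumes "n \<ge> 1"
  shows "stirling_remainder (Suc n) \<le> stirling_remainder n"
    and "stirling_remainder n - stirling_remainder (Suc n) \<le> 1 / (4 * real n) - 1 / (4 * real (Suc n))"
proof -
  have n: "real n > 0"
    using assms by simp
  have "ln (fact (Suc n) :: real) = ln (real (Suc n)) + ln (fact n)"
    by (subst fact_Suc, subst ln_mult) auto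
  then have eq: "stirling_remainder n - stirling_remainder (Suc n)
      = (real n + 1 / 2) * (ln (real n + 1) - ln (real n)) - 1"
    using n by (simp add: stirling_remainder_def algebra_simps del: fact_Suc)
  have "2 / (2 * real n + 1) \<le> ln (real n + 1) - ln (real n)"
    using ln_inverse_approx_ge[of "real n" "real n + 1"] n by simp
  then have "1 \<le> (real n + 1 / 2) * (ln (real n + 1) - ln (real n))"
    using n by (simp add: field_simps)
  with eq show "stirling_remainder (Suc n) \<le> stirling_remainder n"
    by simp
  have "ln (real n + 1) - ln (real n) \<le> (inverse (real n) + inverse (real n + 1)) / 2"
    using ln_inverse_approx_le[of "real n" 1] n by simp
  then have "(real n + 1 / 2) * (ln (real n + 1) - ln (real n)) - 1
      \<le> (real n + 1 / 2) * ((inverse (real n) + inverse (real n + 1)) / 2) - 1"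
    by (intro diff_right_mono mult_left_mono) auto
  also have "\<dots> = 1 / (4 * real n) - 1 / (4 * real (Suc n))"
    using n by (simp add: divide_simps) (simp add: algebra_simps)
  finally show "stirling_remainder n - stirling_remainder (Suc n) \<le> 1 / (4 * real n) - 1 / (4 * real (Suc n))"
    using eq by simp
qed

text \<open>The denominators factor as \<open>(2 * k - 1) * (2 * k + 1)\<close>, while
  \<open>4 ^ n * fact n ^ 2 / fact (2 * n)\<close> is the product of the
  \<open>2 * k / (2 * k - 1)\<close>. Its square therefore misses only the last odd factor
  \<open>2 * n + 1\<close>.\<close>

lemma wallis_product_eq:
  "(\<Prod>k=1..n. (4 * real k ^ 2) / (4 * real k ^ 2 - 1))
     = (4 ^ n * fact n ^ 2 / fact (2 * n)) ^ 2 / (2 * real n + 1)"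
proof (induction n)
  case (Suc n)
  define b where "b = (\<lambda>n. 4 ^ n * fact n ^ 2 / fact (2 * n) :: real)"
  have nz: "2 * real n + 1 \<noteq> 0" "2 * real n + 3 \<noteq> 0" "real (Suc n) \<noteq> 0"
    by linarith+
  have odd: "2 * real (Suc n) + 1 = 2 * real n + 3"
    by simp
  have "fact (2 * Suc n) = 2 * real (Suc n) * (2 * real n + 1) * fact (2 * n)"
    by (simp add: algebra_simps)
  then have b: "b (Suc n) = b n * (2 * real (Suc n) / (2 * real n + 1))"
    using nz by (simp add: b_def divide_simps power2_eq_square del: of_nat_Suc mult_Suc_right)
  have "4 * (real (Suc n))\<^sup>2 - 1 = (2 * real n + 1) * (2 * real n + 3)"
    by (simp add: power2_eq_square algebra_simps)
  then have "(\<Prod>k=1..Suc n. (4 * real k ^ 2) / (4 * real k ^ 2 - 1))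
      = b n ^ 2 / (2 * real n + 1) * (4 * real (Suc n) ^ 2 / ((2 * real n + 1) * (2 * real n + 3)))"
    using Suc.IH by (simp add: b_def del: of_nat_Suc)
  also have "\<dots> = b (Suc n) ^ 2 / (2 * real (Suc n) + 1)"
    unfolding b odd by (simp add: power2_eq_square mult_ac del: of_nat_Suc)
  finally show ?case
    by (simp only: b_def)
qed auto

text \<open>In this combination the linear terms and the multiples of \<open>n * ln n\<close>
  cancel. What remains is \<open>ln (4 ^ n * fact n ^ 2 / fact (2 * n)) + (ln 2 - ln n) / 2\<close>,
  which Wallis' product expresses.\<close>

lemma stirling_remainder_duplication:
  assumes "n \<ge> 1"
  shows "2 * stirling_remainder n - stirling_remainder (2 * n)
     = (ln (\<Prod>k=1..n. (4 * real k ^ 2) / (4 * real k ^ 2 - 1)) + ln (4 + 2 / real n)) / 2"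
proof -
  have n: "real n > 0"
    using assms by simp
  have "4 + 2 / real n = 2 * (2 * real n + 1) / real n"
    using n by (simp add: field_simps)
  also have "ln \<dots> = ln (2 * (2 * real n + 1)) - ln (real n)"
    using n by (intro ln_divide_pos) auto
  also have "ln (2 * (2 * real n + 1)) = ln 2 + ln (2 * real n + 1)"
    using n by (intro ln_mult_pos) auto
  finally have "ln (4 + 2 / real n) = ln 2 + ln (2 * real n + 1) - ln (real n)" .
  moreover have "ln (4::real) = 2 * ln 2"
    using ln_realpow[of 2 2] by simp
  ultimately show ?thesis
    unfolding wallis_product_eq stirling_remainder_def
    using n by (simp add: ln_mult ln_div ln_realpow algebra_simps)
qed

lemma stirling_remainder_ge:
  assumes "k \<ge> 1"
  shows "stirling_remainder k \<ge> ln (2 * pi) / 2"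
proof -
  \<comment> \<open>The shift keeps the index positive, where monotonicity holds.\<close>
  define L where "L = (\<lambda>n. stirling_remainder (Suc n))"
  have dec: "decseq L"
    unfolding L_def by (intro decseq_SucI stirling_remainder_step) simp
  \<comment> \<open>The telescoping bound makes the corrected sequence increase, so \<open>L\<close>
    is bounded below by \<open>L 0 - 1 / 4\<close> and converges.\<close>
  have inc: "incseq (\<lambda>n. L n - 1 / (4 * real (Suc n)))"
  proof (rule incseq_SucI)
    fix n
    show "L n - 1 / (4 * real (Suc n)) \<le> L (Suc n) - 1 / (4 * real (Suc (Suc n)))"
      using stirling_remainder_step(2)[of "Suc n"] by (simp add: L_def)
  qed
  have "L n \<ge> L 0 - 1 / 4" for n
  proof -
    have "L 0 - 1 / 4 \<le> L n - 1 / (4 * real (Suc n))"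
      using incseqD[OF inc, of 0 n] by simp
    then show ?thesis
      by (smt (verit) of_nat_0_le_iff zero_le_divide_1_iff)
  qed
  then obtain c where c: "L \<longlonglongrightarrow> c" and ge: "\<And>n. c \<le> L n"
    using decseq_convergent[OF dec] by metis
  have "stirling_remainder \<longlonglongrightarrow> c"
    using c unfolding L_def by (simp add: filterlim_sequentially_Suc)
  moreover from this have "(\<lambda>n. stirling_remainder (2 * n)) \<longlonglongrightarrow> c"
    by (rule filterlim_compose) (auto intro!: filterlim_subseq strict_monoI)
  \<comment> \<open>The limit of this combination is \<open>c\<close> itself, so Wallis' limit
    \<open>pi / 2\<close> determines \<open>c\<close>.\<close>
  ultimately have "(\<lambda>n. 2 * stirling_remainder n - stirling_remainder (2 * n)) \<longlonglongrightarrow> 2 * c - c"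
    by (intro tendsto_intros)
  moreover have "(\<lambda>n. 2 * stirling_remainder n - stirling_remainder (2 * n)) \<longlonglongrightarrow> (ln (pi / 2) + ln (4 + 0)) / 2"
  proof (rule Lim_transform_eventually)
    show "(\<lambda>n. (ln (\<Prod>k=1..n. (4 * real k ^ 2) / (4 * real k ^ 2 - 1)) + ln (4 + 2 / real n)) / 2)
        \<longlonglongrightarrow> (ln (pi / 2) + ln (4 + 0)) / 2"
      by (intro tendsto_intros wallis tendsto_divide_0[OF tendsto_const]
          filterlim_at_top_imp_at_infinity filterlim_real_sequentially) auto
    show "\<forall>\<^sub>F n in sequentially. (ln (\<Prod>k=1..n. (4 * real k ^ 2) / (4 * real k ^ 2 - 1)) + ln (4 + 2 / real n)) / 2
        = 2 * stirling_remainder n - stirling_remainder (2 * n)"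
      using eventually_ge_at_top[of 1] by eventually_elim (simp only: stirling_remainder_duplication)
  qed
  ultimately have "2 * c - c = (ln (pi / 2) + ln (4 + 0)) / 2"
    by (rule LIMSEQ_unique)
  moreover have "ln (pi / 2) + ln 4 = ln (pi / 2 * 4)"
    by (intro ln_mult_pos [symmetric]) auto
  ultimately have "c = ln (2 * pi) / 2"
    by simp
  with ge[of "k - 1"] assms show ?thesis
    by (simp add: L_def)
qed

text \<open>The logarithm of the left side equals
  \<open>- stirling_remainder k - ln k / 2\<close>.\<close>

lemma poisson_mode_le:
  assumes "k \<ge> 1"
  shows "exp (- real k) * real k ^ k / fact k \<le> 1 / sqrt (2 * pi * real k)"
proof -
  have k: "real k > 0"
    using assms by simp
  have "ln (exp (- real k) * real k ^ k / fact k) \<le> ln (1 / sqrt (2 * pi * real k))"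
    using stirling_remainder_ge[OF assms] k
    by (simp add: stirling_remainder_def ln_mult ln_div ln_realpow ln_sqrt algebra_simps add_divide_distrib)
  then show ?thesis
    using k by (subst (asm) ln_le_cancel_iff) auto
qed

theorem corollary2:
  fixes k :: nat
  assumes "k \<ge> 1"
  shows "convergent (\<lambda>l. P k l) \<and> lim (\<lambda>l. P k l) \<ge> 1 / 2 - 1 / sqrt (2 * pi * real k)"
proof -
  have "(\<Sum>j\<le>k. exp (- real k) * real k ^ j / fact j)
      = (\<Sum>j<k. exp (- real k) * real k ^ j / fact j) + exp (- real k) * real k ^ k / fact k"
    by (simp flip: lessThan_Suc_atMost)
  with poisson_median_ge[OF assms] poisson_mode_le[OF assms]
  have "1 / 2 - 1 / sqrt (2 * pi * real k) \<le> (\<Sum>j<k. exp (- real k) * real k ^ j / fact j)"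
    by linarith
  with P_tendsto_poisson_cdf[OF assms] show ?thesis
    by (auto simp: convergent_def limI)
qed

end
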